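(* The transform $\mathfrak{B}$ maps $\mathcal{O}$ to itself. Moreover, for $f\in\mathcal{O}$ one has $\mathfrak{B}^2 f=\mathfrak{B}(\mathfrak{B}f)=f$ if and only if $f$ is monotonically increasing and convex.
   Context: Fix an integer $n\ge 1$. $\mathbb{R}^n_+$ is the set of vectors in $\mathbb{R}^n$ with all coordinates nonnegative, $\mathbb{R}_+=[0,\infty)$, $\langle\cdot,\cdot\rangle$ is the standard inner product and $\|\cdot\|$ the Euclidean norm. $\mathcal{O}$ is the set of functions $f:\mathbb{R}^n_+\to\mathbb{R}_+$ that are (1) positive affine: $f(\lambda p)=\lambda f(p)$ for all $\lambda>0$, $p\in\mathbb{R}^n_+$; (2) nondegenerate: $f(p)>0$ for all $p\in\mathbb{R}^n_+$, $p\neq 0$; (3) bounded: there are constants $c_1,c_2>0$ with $c_1\|p\|\le f(p)\le c_2\|p\|$ for all $p\in\mathbb{R}^n_+$; (4) continuous. For $f\in\mathcal{O}$, $\mathfrak{B}f$ is the function on $\mathbb{R}^n_+$ given by $(\mathfrak{B}f)(p)=\sup_{q\in\mathbb{R}^n_+,\,q\neq 0}\frac{\langle p,q\rangle}{f(q)}$. A function $f:\mathbb{R}^n_+\to\mathbb{R}_+$ is convex if $f(\mu p_1+(1-\mu)p_2)\le\mu f(p_1)+(1-\mu)f(p_2)$ for all $p_1,p_2\in\mathbb{R}^n_+$, $\mu\in[0,1]$, and monotonically increasing if $f(p)\le f(p+q)$ for all $p,q\in\mathbb{R}^n_+$. *)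

theory Defs
  imports "HOL-Analysis.Analysis"
begin

text \<open>
  A function on the nonnegative orthant is represented by a total function on \<open>real ^ 'n\<close>;
  its values off the orthant are never inspected.
\<close>

definition orthant :: "(real ^ 'n) set" where
  "orthant = {p. \<forall>i. 0 \<le> p $ i}"

definition positive_affine :: "(real ^ 'n \<Rightarrow> real) \<Rightarrow> bool" where
  "positive_affine f \<longleftrightarrow> (\<forall>c>0. \<forall>p\<in>orthant. f (c *\<^sub>R p) = c * f p)"

definition nondegenerate :: "(real ^ 'n \<Rightarrow> real) \<Rightarrow> bool" where
  "nondegenerate f \<longleftrightarrow> (\<forall>p\<in>orthant. p \<noteq> 0 \<longrightarrow> f p > 0)"

definition norm_bounded :: "(real ^ 'n \<Rightarrow> real) \<Rightarrow> bool" where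
  "norm_bounded f \<longleftrightarrow>
    (\<exists>c1>0. \<exists>c2>0. \<forall>p\<in>orthant. c1 * norm p \<le> f p \<and> f p \<le> c2 * norm p)"

definition class_O :: "(real ^ 'n \<Rightarrow> real) set" where
  "class_O = {f. f \<in> orthant \<rightarrow> {0..} \<and> positive_affine f \<and> nondegenerate f \<and>
     norm_bounded f \<and> continuous_on orthant f}"

definition transform_B :: "(real ^ 'n \<Rightarrow> real) \<Rightarrow> real ^ 'n \<Rightarrow> real" where
  "transform_B f p = (SUP q\<in>orthant - {0}. (p \<bullet> q) / f q)"

definition monotonically_increasing :: "(real ^ 'n \<Rightarrow> real) \<Rightarrow> bool" where
  "monotonically_increasing f \<longleftrightarrow> (\<forall>p\<in>orthant. \<forall>q\<in>orthant. f p \<le> f (p + q))"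

text \<open>
  For members of \<open>class_O\<close> the real-valued supremum above is a genuine one: it ranges over
  a nonempty set that is bounded above.
\<close>

lemma orthant_minus_zero_nonempty: "orthant - {0 :: real ^ 'n} \<noteq> {}"
proof -
  have "(1 :: real ^ 'n) \<in> orthant - {0}"
    by (simp add: orthant_def)
  then show ?thesis by blast
qed

lemma bdd_above_transform_B:
  fixes f :: "real ^ 'n \<Rightarrow> real"
  assumes "f \<in> class_O"
  shows "bdd_above ((\<lambda>q. (p \<bullet> q) / f q) ` (orthant - {0}))"
proof -
  obtain c where c: "c > 0" "\<And>q. q \<in> orthant \<Longrightarrow> c * norm q \<le> f q"
    using assms unfolding class_O_def norm_bounded_def by blast
  have "(p \<bullet> q) / f q \<le> norm p / c" if q: "q \<in> orthant - {0}" for q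
  proof -
    have pos: "0 < c * norm q" using c(1) q by simp
    then have fpos: "0 < f q" using c(2)[of q] q by simp
    have "(p \<bullet> q) / f q \<le> (norm p * norm q) / f q"
      using norm_cauchy_schwarz[of p q] pos c(2)[of q] q
      by (intro divide_right_mono) auto
    also have "\<dots> \<le> (norm p * norm q) / (c * norm q)"
      using pos fpos c(2)[of q] q by (intro divide_left_mono mult_nonneg_nonneg mult_pos_pos[OF fpos pos]) auto
    also have "\<dots> = norm p / c" using q by simp
    finally show ?thesis .
  qed
  then show ?thesis by (rule bdd_aboveI2)
qed

end

theory Submission imports Defs begin

text \<open>
  The transform is a gauge duality. Its defining supremum makes \<open>transform_B f\<close> the least
  function \<open>g\<close> with \<open>p \<bullet> q \<le> f q * g p\<close> for all \<open>q\<close> in the orthant, and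
  a supremum of linear functionals with nonnegative coefficients is sublinear, monotone
  on the orthant and, given the lower bound on \<open>f\<close>, Lipschitz. This yields both that the class is preserved and that a function fixed by the double
  transform is monotone and convex.

  The inequality is symmetric in the two factors, so the double transform never exceeds \<open>f\<close>
  (\<open>double_transform_B_le\<close>). For the opposite bound, when \<open>f\<close> is monotone and convex, let
  \<open>0 < t < f p\<close> and consider the points lying coordinatewise below some point of the sublevel set
  \<open>{y \<in> orthant. f y \<le> t}\<close>. They form a set that is convex because \<open>f\<close> is, closed because the
  sublevel set is compact, and that misses \<open>p\<close> because \<open>f\<close> is monotone. A hyperplane separating \<open>p\<close>
  from it has a normal vector \<open>q\<close> in the orthant, because the set is unbounded
  in every negative coordinate direction; and homogeneity turns the separation into \<open>(p \<bullet> q) / transform_B f q \<ge> t\<close> (\<open>double_transform_B_ge\<close>).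
\<close>

section \<open>The orthant and the class\<close>

lemma zero_in_orthant: "0 \<in> orthant"
  by (simp add: orthant_def)

lemma orthant_scaleR: "0 \<le> c \<Longrightarrow> p \<in> orthant \<Longrightarrow> c *\<^sub>R p \<in> orthant"
  by (simp add: orthant_def)

lemma orthant_add: "p \<in> orthant \<Longrightarrow> q \<in> orthant \<Longrightarrow> p + q \<in> orthant"
  by (simp add: orthant_def)

lemma convex_orthant: "convex orthant"
  by (simp add: convex_def orthant_add orthant_scaleR)

lemma closed_orthant: "closed (orthant :: (real ^ 'n) set)"
proof -
  have "closed (\<Inter>i. {p :: real ^ 'n. 0 \<le> p $ i})"
    by (intro closed_INT ballI closed_Collect_le continuous_intros)
  moreover have "orthant = (\<Inter>i. {p :: real ^ 'n. 0 \<le> p $ i})"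
    by (auto simp: orthant_def)
  ultimately show ?thesis by simp
qed

lemma orthant_inner_nonneg: "p \<in> orthant \<Longrightarrow> q \<in> orthant \<Longrightarrow> 0 \<le> p \<bullet> q"
  by (simp add: orthant_def inner_vec_def sum_nonneg)

lemma class_O_pos: "f \<in> class_O \<Longrightarrow> p \<in> orthant - {0} \<Longrightarrow> 0 < f p"
  by (simp add: class_O_def nondegenerate_def)

lemma class_O_zero: "f \<in> class_O \<Longrightarrow> f 0 = 0"
  using zero_in_orthant by (force simp: class_O_def norm_bounded_def)

lemma class_O_scaleR: "f \<in> class_O \<Longrightarrow> 0 < c \<Longrightarrow> p \<in> orthant \<Longrightarrow> f (c *\<^sub>R p) = c * f p"
  by (simp add: class_O_def positive_affine_def)

section \<open>The transform as a supremum of linear functionals\<close>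

lemma transform_B_upper:
  assumes "f \<in> class_O" "q \<in> orthant - {0}"
  shows "(p \<bullet> q) / f q \<le> transform_B f p"
  unfolding transform_B_def
  by (rule cSUP_upper[OF assms(2) bdd_above_transform_B[OF assms(1)]])

lemma transform_B_least:
  assumes "\<And>q. q \<in> orthant - {0} \<Longrightarrow> (p \<bullet> q) / f q \<le> M"
  shows "transform_B f p \<le> M"
  unfolding transform_B_def
  by (rule cSUP_least[OF orthant_minus_zero_nonempty assms])

lemma inner_le_transform_B:
  assumes "f \<in> class_O" "q \<in> orthant"
  shows "p \<bullet> q \<le> f q * transform_B f p"
proof (cases "q = 0")
  case True
  then show ?thesis using class_O_zero[OF assms(1)] by simp
next
  case False
  then show ?thesis
    using transform_B_upper[OF assms(1), of q p] class_O_pos[OF assms(1), of q] assms(2)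
    by (simp add: field_simps)
qed

lemma transform_B_le_norm:
  fixes f :: "real ^ 'n \<Rightarrow> real"
  assumes "f \<in> class_O" "0 < c" "\<And>q. q \<in> orthant \<Longrightarrow> c * norm q \<le> f q"
  shows "transform_B f p \<le> norm p / c"
proof (rule transform_B_least)
  fix q :: "real ^ 'n" assume q: "q \<in> orthant - {0}"
  have "c * (p \<bullet> q) \<le> c * (norm p * norm q)"
    using assms(2) norm_cauchy_schwarz[of p q] by simp
  also have "\<dots> = norm p * (c * norm q)" by simp
  also have "\<dots> \<le> norm p * f q"
    using assms(3)[of q] q by (intro mult_left_mono) auto
  finally show "(p \<bullet> q) / f q \<le> norm p / c"
    using assms(2) class_O_pos[OF assms(1) q] by (simp add: field_simps)
qed

lemma transform_B_ge_norm:
  assumes "f \<in> class_O" "0 < c" "\<And>q. q \<in> orthant \<Longrightarrow> f q \<le> c * norm q" "p \<in> orthant"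
  shows "norm p / c \<le> transform_B f p"
proof (cases "p = 0")
  case True
  then show ?thesis by (simp add: transform_B_def cSUP_const[OF orthant_minus_zero_nonempty])
next
  case False
  then have p: "p \<in> orthant - {0}" using assms(4) by simp
  have "norm p * f p \<le> norm p * (c * norm p)"
    using assms(3,4) by (intro mult_left_mono) auto
  \<comment> \<open>The supremum is tested at \<open>q = p\<close>.\<close>
  then have "norm p / c \<le> (p \<bullet> p) / f p"
    using assms(2) class_O_pos[OF assms(1) p]
    by (simp add: field_simps power2_norm_eq_inner[symmetric] power2_eq_square)
  also have "\<dots> \<le> transform_B f p" by (rule transform_B_upper[OF assms(1) p])
  finally show ?thesis .
qed

lemma transform_B_add_le:
  fixes f :: "real ^ 'n \<Rightarrow> real"
  assumes "f \<in> class_O"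
  shows "transform_B f (p + q) \<le> transform_B f p + transform_B f q"
proof (rule transform_B_least)
  fix r :: "real ^ 'n" assume r: "r \<in> orthant - {0}"
  show "((p + q) \<bullet> r) / f r \<le> transform_B f p + transform_B f q"
    using transform_B_upper[OF assms r, of p] transform_B_upper[OF assms r, of q]
    by (simp add: inner_add_left add_divide_distrib)
qed

lemma transform_B_scaleR:
  fixes f :: "real ^ 'n \<Rightarrow> real"
  assumes "f \<in> class_O" "0 < c"
  shows "transform_B f (c *\<^sub>R p) = c * transform_B f p"
proof (rule antisym)
  have le: "transform_B f (d *\<^sub>R x) \<le> d * transform_B f x" if "0 < d" for d x
  proof (rule transform_B_least)
    fix q :: "real ^ 'n" assume q: "q \<in> orthant - {0}"
    show "((d *\<^sub>R x) \<bullet> q) / f q \<le> d * transform_B f x"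
      using mult_left_mono[OF transform_B_upper[OF assms(1) q, of x], of d] that by simp
  qed
  show "transform_B f (c *\<^sub>R p) \<le> c * transform_B f p" by (rule le[OF assms(2)])
  \<comment> \<open>The other inequality is the same one, for scaling back by \<open>inverse c\<close>.\<close>
  show "c * transform_B f p \<le> transform_B f (c *\<^sub>R p)"
    using le[of "inverse c" "c *\<^sub>R p"] assms(2) by (simp add: field_simps)
qed

lemma transform_B_mono:
  fixes f :: "real ^ 'n \<Rightarrow> real"
  assumes "f \<in> class_O"
  shows "monotonically_increasing (transform_B f)"
  unfolding monotonically_increasing_def
proof (intro ballI transform_B_least)
  fix p q r :: "real ^ 'n"
  assume q: "q \<in> orthant" and r: "r \<in> orthant - {0}"
  have "(p \<bullet> r) / f r \<le> ((p + q) \<bullet> r) / f r"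
    using orthant_inner_nonneg[OF q, of r] r class_O_pos[OF assms r]
    by (intro divide_right_mono) (auto simp: inner_add_left)
  also have "\<dots> \<le> transform_B f (p + q)" by (rule transform_B_upper[OF assms r])
  finally show "(p \<bullet> r) / f r \<le> transform_B f (p + q)" .
qed

lemma transform_B_convex:
  fixes f :: "real ^ 'n \<Rightarrow> real"
  assumes "f \<in> class_O"
  shows "convex_on orthant (transform_B f)"
proof (rule convex_onI)
  fix t :: real and x y :: "real ^ 'n"
  assume "0 < t" "t < 1"
  then show "transform_B f ((1 - t) *\<^sub>R x + t *\<^sub>R y)
      \<le> (1 - t) * transform_B f x + t * transform_B f y"
    using transform_B_add_le[OF assms, of "(1 - t) *\<^sub>R x" "t *\<^sub>R y"]
    by (simp add: transform_B_scaleR[OF assms])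
qed (rule convex_orthant)

text \<open>
  A subadditive function bounded above by a multiple of the norm is Lipschitz, because each
  difference of values is at most the value at the difference of the arguments.
\<close>

lemma continuous_on_transform_B:
  assumes "f \<in> class_O"
  shows "continuous_on A (transform_B f)"
proof -
  obtain c where c: "0 < c" "\<And>q. q \<in> orthant \<Longrightarrow> c * norm q \<le> f q"
    using assms unfolding class_O_def norm_bounded_def by blast
  have diff: "transform_B f x - transform_B f y \<le> norm (x - y) / c" for x y
    using transform_B_add_le[OF assms, of "x - y" y] transform_B_le_norm[OF assms c, of "x - y"]
    by simp
  have "(1 / c)-lipschitz_on A (transform_B f)"
  proof (rule lipschitz_onI)
    fix x y
    show "dist (transform_B f x) (transform_B f y) \<le> 1 / c * dist x y"
      using diff[of x y] diff[of y x] by (simp add: dist_norm abs_le_iff norm_minus_commute)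
  qed (use c in simp)
  then show ?thesis by (rule lipschitz_on_continuous_on)
qed

lemma transform_B_class_O:
  assumes "f \<in> class_O"
  shows "transform_B f \<in> class_O"
proof -
  obtain c d where c: "0 < c" "\<And>q. q \<in> orthant \<Longrightarrow> c * norm q \<le> f q"
    and d: "0 < d" "\<And>q. q \<in> orthant \<Longrightarrow> f q \<le> d * norm q"
    using assms unfolding class_O_def norm_bounded_def by blast
  have lo: "norm p / d \<le> transform_B f p" if "p \<in> orthant" for p
    by (rule transform_B_ge_norm[OF assms d that])
  have up: "transform_B f p \<le> norm p / c" for p
    by (rule transform_B_le_norm[OF assms c])
  have "0 \<le> transform_B f p" if "p \<in> orthant" for p
    using d(1) by (intro order_trans[OF _ lo[OF that]]) simp
  moreover have "0 < transform_B f p" if "p \<in> orthant" "p \<noteq> 0" for p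
    using d(1) that(2) by (intro less_le_trans[OF _ lo[OF that(1)]]) simp
  moreover have "norm_bounded (transform_B f)"
    unfolding norm_bounded_def
    using c(1) d(1) lo up by (intro exI[of _ "1 / d"] exI[of _ "1 / c"] conjI ballI) auto
  ultimately show ?thesis
    by (simp add: class_O_def positive_affine_def nondegenerate_def
        transform_B_scaleR[OF assms] continuous_on_transform_B[OF assms])
qed

section \<open>The double transform\<close>

lemma double_transform_B_le:
  fixes f :: "real ^ 'n \<Rightarrow> real"
  assumes "f \<in> class_O" "p \<in> orthant"
  shows "transform_B (transform_B f) p \<le> f p"
proof (rule transform_B_least)
  fix q :: "real ^ 'n" assume q: "q \<in> orthant - {0}"
  show "(p \<bullet> q) / transform_B f q \<le> f p"
    using inner_le_transform_B[OF assms, of q] class_O_pos[OF transform_B_class_O[OF assms(1)] q]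
    by (simp add: inner_commute field_simps)
qed

lemma compact_sublevel_class_O:
  assumes "f \<in> class_O"
  shows "compact {y \<in> orthant. f y \<le> t}"
proof -
  obtain c where c: "0 < c" "\<And>q. q \<in> orthant \<Longrightarrow> c * norm q \<le> f q"
    using assms unfolding class_O_def norm_bounded_def by blast
  have "norm y \<le> t / c" if "y \<in> {y \<in> orthant. f y \<le> t}" for y
    using c(2)[of y] that c(1) by (simp add: field_simps)
  then have "bounded {y \<in> orthant. f y \<le> t}" by (rule boundedI)
  moreover have "closed {y \<in> orthant. f y \<le> t}"
    using assms closed_orthant
    by (intro continuous_on_closed_Collect_le continuous_on_const) (auto simp: class_O_def)
  ultimately show ?thesis by (simp add: compact_eq_bounded_closed)
qed

lemma convex_sublevel:
  assumes "convex_on S f"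
  shows "convex {x \<in> S. f x \<le> t}"
  unfolding convex_def
proof (intro ballI allI impI)
  fix x y and u v :: real
  assume xy: "x \<in> {x \<in> S. f x \<le> t}" "y \<in> {x \<in> S. f x \<le> t}"
    and uv: "0 \<le> u" "0 \<le> v" "u + v = 1"
  then have "f (u *\<^sub>R x + v *\<^sub>R y) \<le> u * f x + v * f y"
    using assms by (simp add: convex_on_def)
  also have "\<dots> \<le> t"
    using xy uv by (intro convex_bound_le) auto
  finally show "u *\<^sub>R x + v *\<^sub>R y \<in> {x \<in> S. f x \<le> t}"
    using convexD[OF convex_on_imp_convex[OF assms]] xy uv by simp
qed

text \<open>
  Only functionals with nonnegative coefficients are bounded above on the negative orthant, since
  along a coordinate direction with a negative coefficient the values grow without bound.
\<close>

lemma bounded_functional_in_orthant: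
  assumes "\<And>z. z \<in> orthant \<Longrightarrow> q \<bullet> (- z) < c"
  shows "q \<in> orthant"
proof -
  have "0 \<le> q $ i" for i
  proof (rule ccontr)
    assume "\<not> 0 \<le> q $ i"
    then have neg: "q $ i < 0" by simp
    have c: "0 < c" using assms[OF zero_in_orthant] by simp
    \<comment> \<open>The length is chosen so that the functional takes exactly the forbidden value \<open>c\<close>.\<close>
    define s where "s = - c / q $ i"
    have "axis i s \<in> orthant"
      using neg c by (auto simp: orthant_def axis_def s_def field_simps)
    from assms[OF this] show False using neg by (simp add: inner_axis s_def)
  qed
  then show ?thesis by (simp add: orthant_def)
qed

text \<open>
  A level \<open>t\<close> strictly below \<open>f p\<close> keeps \<open>p\<close> at a positive distance from the set \<open>C\<close>, so that
  strict separation applies; positivity of \<open>t\<close> allows every ray to be rescaled to that level.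
\<close>

lemma double_transform_B_ge:
  fixes f :: "real ^ 'n \<Rightarrow> real"
  assumes f: "f \<in> class_O" and mono: "monotonically_increasing f" and conv: "convex_on orthant f"
    and p: "p \<in> orthant" and t: "0 < t" "t < f p"
  shows "t \<le> transform_B (transform_B f) p"
proof -
  define K where "K = {y \<in> orthant. f y \<le> t}"
  define C where "C = (\<Union>y\<in>K. \<Union>z\<in>orthant. {y - z})"
  have "convex K"
    unfolding K_def by (rule convex_sublevel[OF conv])
  then have "convex C"
    unfolding C_def by (rule convex_differences[OF _ convex_orthant])
  moreover have "closed C"
    unfolding C_def K_def
    by (rule compact_closed_differences[OF compact_sublevel_class_O[OF f] closed_orthant])
  moreover have "p \<notin> C"
  proof
    assume "p \<in> C"
    then obtain z where "z \<in> orthant" "f (p + z) \<le> t"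
      by (auto simp: C_def K_def)
    then show False using mono p t(2) by (force simp: monotonically_increasing_def)
  qed
  ultimately have "\<exists>a b. a \<bullet> p < b \<and> (\<forall>x\<in>C. b < a \<bullet> x)"
    by (rule separating_hyperplane_closed_point)
  then obtain a b where ab: "a \<bullet> p < b" "\<And>x. x \<in> C \<Longrightarrow> b < a \<bullet> x"
    by blast
  \<comment> \<open>Turned around, the functional is small on \<open>C\<close> and large at \<open>p\<close>.\<close>
  define q where "q = - a"
  define c where "c = - b"
  have qp: "c < q \<bullet> p" and qC: "\<And>x. x \<in> C \<Longrightarrow> q \<bullet> x < c"
    using ab by (auto simp: q_def c_def)
  have "0 \<in> K" using t zero_in_orthant class_O_zero[OF f] by (simp add: K_def)
  then have "- z \<in> C" if "z \<in> orthant" for z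
    using that unfolding C_def by force
  then have q: "q \<in> orthant" by (intro bounded_functional_in_orthant[of q c] qC)
  have "K \<subseteq> C" using zero_in_orthant by (force simp: C_def)
  then have "0 \<in> C" using \<open>0 \<in> K\<close> by blast
  then have c: "0 < c" using qC by force
  then have "q \<noteq> 0" using qp by auto
  then have q': "q \<in> orthant - {0}" using q by simp
  have "transform_B f q \<le> c / t"
  proof (rule transform_B_least)
    fix r :: "real ^ 'n" assume r: "r \<in> orthant - {0}"
    have fr: "0 < f r" by (rule class_O_pos[OF f r])
    \<comment> \<open>By homogeneity \<open>r\<close> may be rescaled to the level \<open>t\<close>, where it lies in \<open>K\<close>.\<close>
    have "(t / f r) *\<^sub>R r \<in> K"
      using fr t r class_O_scaleR[OF f, of "t / f r" r] by (simp add: K_def orthant_scaleR)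
    then have "q \<bullet> ((t / f r) *\<^sub>R r) < c" using qC \<open>K \<subseteq> C\<close> by blast
    then show "(q \<bullet> r) / f r \<le> c / t" using fr t by (simp add: field_simps)
  qed
  then have "t * transform_B f q \<le> p \<bullet> q"
    using qp t by (simp add: field_simps inner_commute)
  then have "t \<le> (p \<bullet> q) / transform_B f q"
    using class_O_pos[OF transform_B_class_O[OF f] q'] by (simp add: field_simps)
  also have "\<dots> \<le> transform_B (transform_B f) p"
    by (rule transform_B_upper[OF transform_B_class_O[OF f] q'])
  finally show ?thesis .
qed

lemma double_transform_B_eq:
  assumes "f \<in> class_O" "monotonically_increasing f" "convex_on orthant f" "p \<in> orthant"
  shows "transform_B (transform_B f) p = f p"
proof (cases "p = 0")
  case True
  then show ?thesis
    using assms(1) by (simp add: class_O_zero transform_B_class_O)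
next
  case False
  then have "0 < f p" using class_O_pos[OF assms(1), of p] assms(4) by simp
  then have "f p \<le> transform_B (transform_B f) p"
    by (rule dense_le_bounded) (rule double_transform_B_ge[OF assms])
  then show ?thesis using double_transform_B_le[OF assms(1,4)] by simp
qed

theorem theorem3:
  "transform_B ` (class_O :: (real ^ 'n \<Rightarrow> real) set) \<subseteq> class_O \<and>
   (\<forall>f\<in>(class_O :: (real ^ 'n \<Rightarrow> real) set).
      (\<forall>p\<in>orthant. transform_B (transform_B f) p = f p) \<longleftrightarrow>
      monotonically_increasing f \<and> convex_on orthant f)"
proof (intro conjI ballI iffI)
  show "transform_B ` (class_O :: (real ^ 'n \<Rightarrow> real) set) \<subseteq> class_O"
    using transform_B_class_O by blast
next
  fix f :: "real ^ 'n \<Rightarrow> real"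
  assume f: "f \<in> class_O" and eq: "\<forall>p\<in>orthant. transform_B (transform_B f) p = f p"
  note Bf = transform_B_class_O[OF f]
  show "monotonically_increasing f"
    using transform_B_mono[OF Bf] eq by (simp add: monotonically_increasing_def orthant_add)
  show "convex_on orthant f"
  proof (rule convex_onI)
    fix t :: real and x y :: "real ^ 'n"
    assume "0 < t" "t < 1" "x \<in> orthant" "y \<in> orthant"
    then show "f ((1 - t) *\<^sub>R x + t *\<^sub>R y) \<le> (1 - t) * f x + t * f y"
      using convex_onD[OF transform_B_convex[OF Bf], of t x y] eq
      by (simp add: orthant_add orthant_scaleR)
  qed (rule convex_orthant)
next
  fix f :: "real ^ 'n \<Rightarrow> real" and p :: "real ^ 'n"
  assume "f \<in> class_O" "monotonically_increasing f \<and> convex_on orthant f" "p \<in> orthant"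
  then show "transform_B (transform_B f) p = f p"
    using double_transform_B_eq by blast
qed

end
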